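(* There is an absolute constant $c_1>0$ such that the following holds. Let $Q,N\ge 1$ be real numbers, let $(a_n)_{n\in\mathbb{N}}$ be any sequence of complex numbers, and put $$S(\alpha):=\sum_{n\le N}a_n e(n\alpha),\qquad Z:=\sum_{n\le N}|a_n|^2,$$ where $e(x)=e^{2\pi i x}$. Let $0\le M\le Q$ and let $\mathcal{S}\subset (M,M+Q]$ be a set of natural numbers. For $t\in\mathbb{N}$ let $\mathcal{S}_t:=\{q\in\mathbb{N}: tq\in\mathcal{S}\}$, and for $u>0$, $t,k\in\mathbb{N}$, $l\in\mathbb{Z}$ define $$A_t(u,k,l):=\max_{M/t\le y\le (M+Q)/t}\bigl|\{q\in\mathcal{S}_t\cap(y,y+u]:\ q\equiv l \bmod k\}\bigr|.$$ Put $U:=1$ if $M<\sqrt N$ and $U:=0$ otherwise. Then $$\sum_{q\in\mathcal{S}}\ \sum_{\substack{a=1\\(a,q)=1}}^{q}\left|S\!\left(\frac aq\right)\right|^2\le c_1NZ\left(U+\max_{r\le\sqrt N}\ \max_{1/N\le z\le 1/(r\sqrt N)}\ \max_{\substack{h\in\mathbb{Z}\\(h,r)=1}}\ \sum_{t\mid r}\ \sum_{\substack{0<m\le 4rzQ/t\\(m,r/t)=1}}A_t\!\left(\frac{Q}{tzN},\frac rt,hm\right)\right),$$ where $r$ ranges over natural numbers.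
   Context: $e(x)=e^{2\pi i x}$. All sums over $n\le N$ are over positive integers $n\le N$. *)

theory Defs
  imports Complex_Main "HOL-Number_Theory.Cong"
begin

definition ee :: "real \<Rightarrow> complex" where
  "ee x = exp (2 * complex_of_real pi * \<i> * complex_of_real x)"

definition exp_sum :: "(nat \<Rightarrow> complex) \<Rightarrow> real \<Rightarrow> real \<Rightarrow> complex" where
  "exp_sum a N \<alpha> = (\<Sum>n | 0 < n \<and> real n \<le> N. a n * ee (real n * \<alpha>))"

definition sq_norm :: "(nat \<Rightarrow> complex) \<Rightarrow> real \<Rightarrow> real" where
  "sq_norm a N = (\<Sum>n | 0 < n \<and> real n \<le> N. (cmod (a n))\<^sup>2)"

definition dilate :: "nat set \<Rightarrow> nat \<Rightarrow> nat set" where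
  "dilate S t = {q. 0 < q \<and> t * q \<in> S}"

definition A_count :: "real \<Rightarrow> real \<Rightarrow> nat set \<Rightarrow> nat \<Rightarrow> real \<Rightarrow> nat \<Rightarrow> int \<Rightarrow> nat" where
  "A_count M Q S t u k l =
     (MAX y \<in> {M / real t .. (M + Q) / real t}.
        card {q \<in> dilate S t. y < real q \<and> real q \<le> y + u \<and> [int q = l] (mod int k)})"

definition divisor_sum :: "real \<Rightarrow> real \<Rightarrow> real \<Rightarrow> nat set \<Rightarrow> nat \<Rightarrow> real \<Rightarrow> int \<Rightarrow> nat" where
  "divisor_sum N M Q S r z h =
     (\<Sum>t | t dvd r.
        \<Sum>m | 0 < m \<and> real m \<le> 4 * real r * z * Q / real t \<and> coprime m (r div t).
          A_count M Q S t (Q / (real t * z * N)) (r div t) (h * int m))"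

definition max_divisor_sum :: "real \<Rightarrow> real \<Rightarrow> real \<Rightarrow> nat set \<Rightarrow> nat" where
  "max_divisor_sum N M Q S =
     (MAX r \<in> {r. 0 < r \<and> real r \<le> sqrt N}.
      MAX z \<in> {1 / N .. 1 / (real r * sqrt N)}.
      MAX h \<in> {h. coprime h (int r)}.
        divisor_sum N M Q S r z h)"

definition U_ind :: "real \<Rightarrow> real \<Rightarrow> real" where
  "U_ind M N = (if M < sqrt N then 1 else 0)"

text \<open>
  The maxima over $y$, $z$ and $h$ run over infinite sets. The facts below show that only finitely
  many values occur, so that \<^const>\<open>Max\<close> is applied to finite nonempty sets only.
\<close>

lemma finite_dilate: "finite (dilate S t)" if "finite S" "0 < t"
proof (rule finite_imageD)
  show "finite ((*) t ` dilate S t)"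
    by (rule finite_subset[OF _ that(1)]) (auto simp: dilate_def)
  show "inj_on ((*) t) (dilate S t)"
    using that(2) by (auto simp: inj_on_def)
qed

lemma finite_A_count_values:
  assumes "finite S" "0 < t"
  shows "finite ((\<lambda>y::real. card {q \<in> dilate S t. y < real q \<and> real q \<le> y + u \<and> [int q = l] (mod int k)}) ` Y)"
    and "card {q \<in> dilate S t. y < real q \<and> real q \<le> y + u \<and> [int q = l] (mod int k)} \<le> card (dilate S t)"
proof -
  have *: "card {q \<in> dilate S t. y < real q \<and> real q \<le> y + u \<and> [int q = l] (mod int k)} \<le> card (dilate S t)" for y
    by (rule card_mono) (use finite_dilate[OF assms] in auto)
  show "finite ((\<lambda>y::real. card {q \<in> dilate S t. y < real q \<and> real q \<le> y + u \<and> [int q = l] (mod int k)}) ` Y)"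
    by (rule finite_subset[of _ "{..card (dilate S t)}"]) (use * in auto)
  show "card {q \<in> dilate S t. y < real q \<and> real q \<le> y + u \<and> [int q = l] (mod int k)} \<le> card (dilate S t)"
    by (rule *)
qed

lemma A_count_le:
  assumes "finite S" "0 < t" "0 \<le> Q"
  shows "A_count M Q S t u k l \<le> card (dilate S t)"
proof -
  have "M / real t \<le> (M + Q) / real t"
    using assms by (intro divide_right_mono) auto
  thus ?thesis
    unfolding A_count_def using finite_A_count_values[OF assms(1,2)]
    by (subst Max_le_iff) auto
qed

lemma finite_range_divisor_sum:
  assumes "finite S" "0 < r" "0 \<le> Q"
  shows "finite {divisor_sum N M Q S r z h | z h. z \<in> {v..w}}"
proof -
  define B where "B t = {m. real m \<le> 4 * real r * w * Q / real t}" for t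
  have fB: "finite (B t)" for t
    unfolding B_def by (rule finite_subset[of _ "{..nat \<lfloor>4 * real r * w * Q / real t\<rfloor>}"])
      (auto simp: le_nat_floor)
  have bound: "divisor_sum N M Q S r z h \<le> (\<Sum>t | t dvd r. \<Sum>m\<in>B t. card (dilate S t))"
    if "z \<in> {v..w}" for z h
    unfolding divisor_sum_def
  proof (rule sum_mono)
    fix t assume "t \<in> {t. t dvd r}"
    hence t: "0 < t" using assms(2) by (auto intro: dvd_pos_nat)
    have "4 * real r * z * Q / real t \<le> 4 * real r * w * Q / real t"
      using that assms t by (intro divide_right_mono mult_right_mono mult_left_mono) auto
    hence sub: "{m. 0 < m \<and> real m \<le> 4 * real r * z * Q / real t \<and> coprime m (r div t)} \<subseteq> B t"
      by (auto simp: B_def)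
    have "(\<Sum>m | 0 < m \<and> real m \<le> 4 * real r * z * Q / real t \<and> coprime m (r div t).
             A_count M Q S t (Q / (real t * z * N)) (r div t) (h * int m))
        \<le> (\<Sum>m | 0 < m \<and> real m \<le> 4 * real r * z * Q / real t \<and> coprime m (r div t).
             card (dilate S t))"
      using A_count_le[OF assms(1) t assms(3)] by (intro sum_mono)
    also have "\<dots> \<le> (\<Sum>m\<in>B t. card (dilate S t))"
      by (rule sum_mono2[OF fB sub]) auto
    finally show "(\<Sum>m | 0 < m \<and> real m \<le> 4 * real r * z * Q / real t \<and> coprime m (r div t).
             A_count M Q S t (Q / (real t * z * N)) (r div t) (h * int m)) \<le> (\<Sum>m\<in>B t. card (dilate S t))" .
  qed
  show ?thesis
  proof (rule finite_subset)
    show "{divisor_sum N M Q S r z h | z h. z \<in> {v..w}}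
        \<subseteq> {..(\<Sum>t | t dvd r. \<Sum>m\<in>B t. card (dilate S t))}"
      using bound unfolding atMost_def by blast
  qed (rule finite_atMost)
qed

lemma max_divisor_sum_well_defined:
  assumes "finite S" "1 \<le> N" "0 \<le> Q"
  shows "finite {r. 0 < r \<and> real r \<le> sqrt N}" and "{r. 0 < r \<and> real r \<le> sqrt N} \<noteq> {}"
    and "0 < r \<Longrightarrow> real r \<le> sqrt N \<Longrightarrow> {1 / N .. 1 / (real r * sqrt N)} \<noteq> {}"
    and "{h. coprime h (int r)} \<noteq> {}"
    and "0 < r \<Longrightarrow> finite ((\<lambda>z. MAX h \<in> {h. coprime h (int r)}. divisor_sum N M Q S r z h) ` {v..w})"
    and "0 < r \<Longrightarrow> finite ((\<lambda>h. divisor_sum N M Q S r z h) ` {h. coprime h (int r)})"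
proof -
  show "finite {r. 0 < r \<and> real r \<le> sqrt N}"
    by (rule finite_subset[of _ "{..nat \<lfloor>sqrt N\<rfloor>}"]) (auto simp: le_nat_floor)
  show "{r. 0 < r \<and> real r \<le> sqrt N} \<noteq> {}"
    using assms by (auto intro!: exI[of _ "1::nat"])
  show ne: "{h. coprime h (int r)} \<noteq> {}" for r
    by (auto intro!: exI[of _ "1::int"])
  show "{1 / N .. 1 / (real r * sqrt N)} \<noteq> {}" if "0 < r" "real r \<le> sqrt N"
  proof -
    have "real r * sqrt N \<le> sqrt N * sqrt N"
      using that assms by (intro mult_right_mono) auto
    hence "real r * sqrt N \<le> N" using assms by simp
    thus ?thesis using that assms by (auto simp: field_simps)
  qed
  show fin: "finite ((\<lambda>h. divisor_sum N M Q S r z h) ` {h. coprime h (int r)})" if "0 < r" for z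
    by (rule finite_subset[OF _ finite_range_divisor_sum[OF assms(1) that assms(3), of N M z z]]) auto
  have "(MAX h \<in> {h. coprime h (int r)}. divisor_sum N M Q S r z h)
      \<in> (\<lambda>h. divisor_sum N M Q S r z h) ` {h. coprime h (int r)}" if "0 < r" for z
    using fin[OF that] ne by (intro Max_in) auto
  thus "finite ((\<lambda>z. MAX h \<in> {h. coprime h (int r)}. divisor_sum N M Q S r z h) ` {v..w})" if "0 < r"
    using that
    by (intro finite_subset[OF _ finite_range_divisor_sum[OF assms(1) that assms(3), of N M v w]]) blast
qed

end

theory Submission
  imports Defs "HOL-Analysis.Convex"
begin

text \<open>
  Let \<open>L = \<lfloor>N\<rfloor> + 1\<close>. Every fraction \<open>a / q\<close> is within \<open>1 / L\<close> of a grid point \<open>j / L\<close>, and summation by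
  parts bounds \<open>S(a / q)\<close> by an average of partial sums of \<open>S(j / L)\<close>. Parseval's identity on the grid
  then bounds the left-hand side by \<open>O(N Z)\<close> times the largest number of fractions in an interval
  of length \<open>1 / N\<close>.

  To count the fractions near \<open>\<alpha>\<close>, approximate \<open>\<alpha> = b / r + \<zeta>\<close> by Dirichlet's theorem and consider
  the numerator of \<open>a / q - b / r\<close>, namely \<open>a r - b q\<close>. If it vanishes then \<open>q = r \<le> \<surd>N\<close>, which is the
  term \<open>U\<close>. Otherwise, with \<open>t = gcd q r\<close> and \<open>a r - b q = \<plusminus> t m\<close>, the number \<open>q / t\<close> lies in a
  fixed residue class modulo \<open>r / t\<close> and in an interval of length \<open>O(Q / (t z N))\<close>, where
  \<open>z = max \<bar>\<zeta>\<bar> (1 / N)\<close>.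
\<close>

section \<open>Additive characters\<close>

lemma ee_cis: "ee x = cis (2 * pi * x)"
  by (simp add: ee_def cis_conv_exp mult_ac)

lemma norm_ee [simp]: "cmod (ee x) = 1"
  by (simp add: ee_cis)

lemma ee_add: "ee (x + y) = ee x * ee y"
  by (simp add: ee_cis cis_mult algebra_simps)

lemma cnj_ee: "cnj (ee x) = ee (- x)"
  by (simp add: ee_cis cis_cnj)

lemma ee_power: "ee x ^ n = ee (real n * x)"
  by (simp add: ee_cis DeMoivre mult_ac)

lemma ee_eq_1_iff: "ee x = 1 \<longleftrightarrow> (\<exists>k::int. x = of_int k)"
proof
  assume "ee x = 1"
  hence "cos (2 * pi * x) = 1"
    by (simp add: ee_cis complex_eq_iff)
  then obtain k :: int where "2 * pi * x = of_int k * 2 * pi"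
    using cos_one_2pi_int by blast
  thus "\<exists>k::int. x = of_int k"
    by auto
next
  assume "\<exists>k::int. x = of_int k"
  then obtain k :: int where "x = of_int k" by blast
  thus "ee x = 1"
    by (simp add: ee_cis cis_multiple_2pi)
qed

text \<open>The chord has length \<open>2 * \<bar>sin (t / 2)\<bar>\<close>, and the arc is no
  shorter than the chord.\<close>

lemma norm_cis_minus_1_le: "cmod (cis t - 1) \<le> \<bar>t\<bar>"
proof -
  have "(cmod (cis t - 1))\<^sup>2 = (cos t - 1)\<^sup>2 + (sin t)\<^sup>2"
    by (simp add: cmod_power2)
  also have "\<dots> = 2 - 2 * cos (2 * (t / 2))"
    using sin_cos_squared_add[of t] by (simp add: power2_eq_square algebra_simps)
  also have "\<dots> = (2 * sin (t / 2))\<^sup>2"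
    unfolding cos_double_sin by (simp add: power_mult_distrib)
  also have "\<dots> \<le> t\<^sup>2"
    using abs_sin_x_le_abs_x[of "t / 2"] by (subst abs_le_square_iff[symmetric]) (simp add: abs_mult)
  finally have "(cmod (cis t - 1))\<^sup>2 \<le> \<bar>t\<bar>\<^sup>2" by simp
  thus ?thesis
    by (rule power2_le_imp_le) simp
qed

lemma norm_ee_diff_le: "cmod (ee x - ee y) \<le> 2 * pi * \<bar>x - y\<bar>"
proof -
  have "ee x - ee y = ee y * (ee (x - y) - 1)"
    by (simp add: algebra_simps flip: ee_add)
  hence "cmod (ee x - ee y) = cmod (ee (x - y) - 1)"
    by (simp add: norm_mult)
  also have "\<dots> \<le> \<bar>2 * pi * (x - y)\<bar>"
    unfolding ee_cis by (rule norm_cis_minus_1_le)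
  finally show ?thesis
    by (simp add: abs_mult)
qed

text \<open>This is a full geometric sum whose ratio \<open>w\<close> is an \<open>L\<close>-th root
  of unity other than 1.\<close>

lemma sum_ee_eq_0:
  assumes "0 < L" "\<not> int L dvd d"
  shows "(\<Sum>j=1..L. ee (of_int d * (real j / real L))) = 0"
proof -
  define w where "w = ee (of_int d / real L)"
  have w1: "w \<noteq> 1"
  proof
    assume "w = 1"
    then obtain k :: int where "of_int d / real L = of_int k"
      unfolding w_def ee_eq_1_iff by blast
    hence "of_int d = (of_int (k * int L) :: real)"
      using assms(1) by (simp add: field_simps)
    hence "d = k * int L"
      by linarith
    thus False
      using assms(2) by simp
  qed
  have wL: "w ^ L = 1"
    using assms(1) by (simp add: w_def ee_power ee_eq_1_iff)
  have "(\<Sum>j=1..L. ee (of_int d * (real j / real L))) = (\<Sum>j=1..L. w ^ j)"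
    by (simp add: w_def ee_power mult_ac)
  also have "\<dots> = (\<Sum>j<L. w ^ Suc j)"
    by (rule sum.reindex_bij_witness[of _ Suc "\<lambda>j. j - 1"]) auto
  also have "\<dots> = w * (\<Sum>j<L. w ^ j)"
    by (simp add: sum_distrib_left)
  also have "\<dots> = 0"
    using w1 wL by (simp add: geometric_sum)
  finally show ?thesis .
qed

text \<open>Expanding the square leaves character sums over the grid. Distinct frequencies in
  \<open>{1..L}\<close> differ by less than \<open>L\<close>, hence are incongruent modulo
  \<open>L\<close>, and only the diagonal survives.\<close>

lemma discrete_parseval:
  fixes a :: "nat \<Rightarrow> complex"
  assumes "0 < L" "A \<subseteq> {1..L}"
  shows "(\<Sum>j=1..L. (cmod (\<Sum>n\<in>A. a n * ee (real n * (real j / real L))))\<^sup>2)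
       = real L * (\<Sum>n\<in>A. (cmod (a n))\<^sup>2)"
proof -
  have fin: "finite A"
    using assms(2) finite_subset by blast
  have orth: "(\<Sum>j=1..L. ee (of_int (int n - int m) * (real j / real L)))
      = (if n = m then of_nat L else 0)" if "n \<in> A" "m \<in> A" for n m
  proof (cases "n = m")
    case False
    have "\<not> int L dvd int n - int m"
    proof
      assume "int L dvd int n - int m"
      moreover have "\<bar>int n - int m\<bar> < int L"
        using subsetD[OF assms(2) that(1)] subsetD[OF assms(2) that(2)] by auto
      ultimately show False
        using False dvd_imp_le_int[of "int n - int m" "int L"] by simp
    qed
    thus ?thesis
      using False sum_ee_eq_0[OF assms(1)] by (simp only: if_False)
  qed (simp add: ee_cis)
  have "complex_of_real (\<Sum>j=1..L. (cmod (\<Sum>n\<in>A. a n * ee (real n * (real j / real L))))\<^sup>2)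
     = (\<Sum>j=1..L. \<Sum>n\<in>A. \<Sum>m\<in>A. a n * cnj (a m) * ee (of_int (int n - int m) * (real j / real L)))"
  proof (simp only: of_real_sum, rule sum.cong[OF refl])
    fix j
    have "complex_of_real ((cmod (\<Sum>n\<in>A. a n * ee (real n * (real j / real L))))\<^sup>2)
       = (\<Sum>n\<in>A. a n * ee (real n * (real j / real L)))
         * (\<Sum>m\<in>A. cnj (a m) * ee (- (real m * (real j / real L))))"
      by (simp only: complex_norm_square cnj_sum complex_cnj_mult cnj_ee)
    also have "\<dots> = (\<Sum>n\<in>A. \<Sum>m\<in>A. a n * cnj (a m) * ee (of_int (int n - int m) * (real j / real L)))"
    proof (simp only: sum_product, intro sum.cong refl)
      fix n m
      have *: "ee (of_int (int n - int m) * (real j / real L))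
          = ee (real n * (real j / real L)) * ee (- (real m * (real j / real L)))"
        unfolding ee_add[symmetric] by (rule arg_cong[of _ _ ee]) (simp add: algebra_simps diff_divide_distrib)
      show "a n * ee (real n * (real j / real L)) * (cnj (a m) * ee (- (real m * (real j / real L))))
          = a n * cnj (a m) * ee (of_int (int n - int m) * (real j / real L))"
        unfolding * by (simp only: mult_ac)
    qed
    finally show "complex_of_real ((cmod (\<Sum>n\<in>A. a n * ee (real n * (real j / real L))))\<^sup>2)
       = (\<Sum>n\<in>A. \<Sum>m\<in>A. a n * cnj (a m) * ee (of_int (int n - int m) * (real j / real L)))" .
  qed
  also have "\<dots> = (\<Sum>n\<in>A. \<Sum>m\<in>A. \<Sum>j=1..L. a n * cnj (a m) * ee (of_int (int n - int m) * (real j / real L)))"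
    by (subst sum.swap, rule sum.cong[OF refl], rule sum.swap)
  also have "\<dots> = (\<Sum>n\<in>A. \<Sum>m\<in>A. a n * cnj (a m) * (if n = m then of_nat L else 0))"
    by (intro sum.cong refl) (simp only: sum_distrib_left[symmetric] orth)
  also have "\<dots> = (\<Sum>n\<in>A. a n * cnj (a n) * of_nat L)"
    using fin by (simp add: if_distrib[where f = "\<lambda>x. _ * x"] sum.delta cong: if_cong)
  also have "\<dots> = complex_of_real (real L * (\<Sum>n\<in>A. (cmod (a n))\<^sup>2))"
    by (simp only: of_real_mult of_real_sum of_real_of_nat_eq complex_norm_square sum_distrib_left mult_ac)
  finally show ?thesis
    by (simp only: of_real_eq_iff)
qed

section \<open>The large sieve with a local point count\<close>

text \<open>Summation by parts moves the differences onto the weights \<open>w\<close>. The bound is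
  useful for slowly varying weights, where \<open>\<delta> * F\<close> is bounded and the last term
  is comparable to an average of the partial sums.\<close>

lemma norm_sum_mult_le_partial_sums:
  fixes x w :: "nat \<Rightarrow> 'a::real_normed_field"
  assumes "\<And>k. norm (w k) \<le> 1" "\<And>k. norm (w (Suc k) - w k) \<le> \<delta>"
  shows "norm (\<Sum>n=1..F. x n * w n)
       \<le> norm (\<Sum>n=1..F. x n) + \<delta> * (\<Sum>k<F. norm (\<Sum>n=1..k. x n))"
proof -
  have "(\<Sum>n=1..F. x n * w n)
      = (\<Sum>n=1..F. x n) * w F - (\<Sum>k<F. (\<Sum>n=1..k. x n) * (w (Suc k) - w k))"
    by (induction F) (simp_all add: algebra_simps)
  also have "norm \<dots> \<le> norm ((\<Sum>n=1..F. x n) * w F)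
      + (\<Sum>k<F. norm ((\<Sum>n=1..k. x n) * (w (Suc k) - w k)))"
    by (rule order_trans[OF norm_triangle_ineq4 add_left_mono[OF norm_sum]])
  also have "\<dots> \<le> norm (\<Sum>n=1..F. x n) * 1 + (\<Sum>k<F. norm (\<Sum>n=1..k. x n) * \<delta>)"
    unfolding norm_mult by (intro add_mono sum_mono mult_left_mono assms norm_ge_zero)
  finally show ?thesis
    by (simp add: sum_distrib_left mult.commute)
qed

text \<open>Cauchy-Schwarz with weight 1 on \<open>u\<close> and weight \<open>\<delta>\<close> on
  each \<open>v k\<close>, so that the total mass is \<open>1 + \<delta> * F\<close>.\<close>

lemma weighted_cauchy_schwarz:
  fixes v :: "nat \<Rightarrow> real"
  assumes "0 \<le> \<delta>"
  shows "(u + \<delta> * (\<Sum>k<F. v k))\<^sup>2 \<le> (1 + \<delta> * real F) * (u\<^sup>2 + \<delta> * (\<Sum>k<F. (v k)\<^sup>2))"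
proof -
  have cs: "(\<Sum>k<F. v k)\<^sup>2 \<le> real F * (\<Sum>k<F. (v k)\<^sup>2)"
    using sum_squared_le_sum_of_squares[of v "{..<F}"] by (simp add: mult.commute)
  have "2 * u * (\<Sum>k<F. v k) = (\<Sum>k<F. 2 * u * v k)"
    by (simp add: sum_distrib_left)
  also have "\<dots> \<le> (\<Sum>k<F. u\<^sup>2 + (v k)\<^sup>2)"
    by (intro sum_mono sum_squares_bound)
  finally have cross: "2 * u * (\<Sum>k<F. v k) \<le> real F * u\<^sup>2 + (\<Sum>k<F. (v k)\<^sup>2)"
    by (simp add: sum.distrib)
  have "\<delta> * (2 * u * (\<Sum>k<F. v k)) \<le> \<delta> * (real F * u\<^sup>2 + (\<Sum>k<F. (v k)\<^sup>2))"
    and "\<delta>\<^sup>2 * (\<Sum>k<F. v k)\<^sup>2 \<le> \<delta>\<^sup>2 * (real F * (\<Sum>k<F. (v k)\<^sup>2))"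
    using assms cs cross by (intro mult_left_mono; simp)+
  thus ?thesis
    by (simp add: power2_eq_square algebra_simps)
qed

text \<open>Each point is moved to the grid point \<open>c x / L\<close> at the right end of its
  cell, a cell receives at most \<open>K\<close> points, and the grid sum is evaluated by Parseval.
  One factor \<open>1 + 2 * pi\<close> comes from Cauchy-Schwarz, the other from summing
  \<open>G\<close> over the grid, and the 2 from \<open>L \<le> 2 * N\<close>.\<close>

lemma large_sieve_local_count:
  fixes a :: "nat \<Rightarrow> complex" and \<theta> :: "'b \<Rightarrow> real"
  assumes "1 \<le> N" "finite X" "0 \<le> K"
    and range: "\<And>x. x \<in> X \<Longrightarrow> 0 < \<theta> x \<and> \<theta> x \<le> 1"
    and count: "\<And>\<alpha>. real (card {x \<in> X. \<bar>\<theta> x - \<alpha>\<bar> \<le> 1 / (2 * N)}) \<le> K"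
  shows "(\<Sum>x\<in>X. (cmod (exp_sum a N (\<theta> x)))\<^sup>2) \<le> 2 * (1 + 2 * pi)\<^sup>2 * K * N * sq_norm a N"
proof -
  define F where "F = nat \<lfloor>N\<rfloor>"
  \<comment> \<open>The grid must be fine enough for a cell to fit into an interval of length
    \<open>1 / N\<close>, which needs \<open>N \<le> L\<close>, and yet have \<open>O(N)\<close>
    points.\<close>
  define L where "L = Suc F"
  have F: "{n. 0 < n \<and> real n \<le> N} = {1..F}"
    using assms(1) by (auto simp: F_def le_nat_floor) linarith
  have L: "0 < L" "N \<le> real L" "real L \<le> 2 * N" "F \<le> L"
    using assms(1) by (auto simp: L_def F_def) linarith+
  \<comment> \<open>This bounds the change of \<open>ee (n * \<eta>)\<close> from one
    \<open>n\<close> to the next when \<open>\<bar>\<eta>\<bar> \<le> 1 / L\<close>.\<close>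
  define \<delta> where "\<delta> = 2 * pi / real L"
  have \<delta>: "0 \<le> \<delta>" "\<delta> * real F \<le> 2 * pi"
    using L by (auto simp: \<delta>_def field_simps)
  define P where "P k j = (\<Sum>n=1..k. a n * ee (real n * (real j / real L)))" for k j
  define G where "G j = (cmod (P F j))\<^sup>2 + \<delta> * (\<Sum>k<F. (cmod (P k j))\<^sup>2)" for j
  \<comment> \<open>Rounding up sends the points of the half-open interval from 0 (excluded) to 1
    exactly into the index range \<open>{1..L}\<close> of the grid.\<close>
  define c where "c x = nat \<lceil>\<theta> x * real L\<rceil>" for x
  have G0: "0 \<le> G j" for j
    unfolding G_def by (intro add_nonneg_nonneg mult_nonneg_nonneg sum_nonneg \<delta>) auto
  have c: "real (c x) - 1 < \<theta> x * real L" "\<theta> x * real L \<le> real (c x)" "c x \<in> {1..L}"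
    if "x \<in> X" for x
  proof -
    have pos: "0 < \<theta> x * real L" "\<theta> x * real L \<le> real L"
      using range[OF that] L(1) by (auto intro: mult_left_le_one_le)
    hence "real (c x) = of_int \<lceil>\<theta> x * real L\<rceil>"
      by (simp add: c_def)
    thus 1: "real (c x) - 1 < \<theta> x * real L" "\<theta> x * real L \<le> real (c x)"
      by linarith+
    show "c x \<in> {1..L}"
      using 1 pos by auto
  qed
  have pointwise: "(cmod (exp_sum a N (\<theta> x)))\<^sup>2 \<le> (1 + 2 * pi) * G (c x)" if "x \<in> X" for x
  proof -
    define \<eta> where "\<eta> = \<theta> x - real (c x) / real L"
    have \<eta>: "\<bar>\<eta>\<bar> \<le> 1 / real L"
    proof -
      have "\<bar>\<eta>\<bar> = \<bar>\<theta> x * real L - real (c x)\<bar> / real L"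
        using L(1) by (simp add: \<eta>_def field_simps abs_divide)
      thus ?thesis
        using c[OF that] by (auto intro: divide_right_mono)
    qed
    \<comment> \<open>The phase splits into the grid part and the slowly varying weight
      \<open>ee (n * \<eta>)\<close>.\<close>
    have "exp_sum a N (\<theta> x)
        = (\<Sum>n=1..F. (a n * ee (real n * (real (c x) / real L))) * ee (real n * \<eta>))"
      unfolding exp_sum_def F
    proof (rule sum.cong[OF refl])
      fix n
      have "real n * \<theta> x = real n * (real (c x) / real L) + real n * \<eta>"
        by (simp add: \<eta>_def algebra_simps)
      thus "a n * ee (real n * \<theta> x) = a n * ee (real n * (real (c x) / real L)) * ee (real n * \<eta>)"
        by (simp only: ee_add mult.assoc)
    qed
    also have "cmod \<dots> \<le> cmod (P F (c x)) + \<delta> * (\<Sum>k<F. cmod (P k (c x)))"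
      unfolding P_def
    proof (rule norm_sum_mult_le_partial_sums)
      fix k
      have "cmod (ee (real (Suc k) * \<eta>) - ee (real k * \<eta>)) \<le> 2 * pi * \<bar>real (Suc k) * \<eta> - real k * \<eta>\<bar>"
        by (rule norm_ee_diff_le)
      also have "real (Suc k) * \<eta> - real k * \<eta> = \<eta>"
        by (simp add: algebra_simps)
      also have "2 * pi * \<bar>\<eta>\<bar> \<le> \<delta>"
        using mult_left_mono[OF \<eta>, of "2 * pi"] by (simp add: \<delta>_def)
      finally show "cmod (ee (real (Suc k) * \<eta>) - ee (real k * \<eta>)) \<le> \<delta>" .
    qed simp
    finally have "(cmod (exp_sum a N (\<theta> x)))\<^sup>2 \<le> (cmod (P F (c x)) + \<delta> * (\<Sum>k<F. cmod (P k (c x))))\<^sup>2"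
      by (rule power_mono) simp
    also have "\<dots> \<le> (1 + \<delta> * real F) * G (c x)"
      unfolding G_def by (rule weighted_cauchy_schwarz[OF \<delta>(1)])
    also have "\<dots> \<le> (1 + 2 * pi) * G (c x)"
      using \<delta> G0 by (intro mult_right_mono) auto
    finally show ?thesis .
  qed
  have cell: "real (card {x \<in> X. c x = j}) \<le> K" for j
  proof -
    \<comment> \<open>The cell runs from \<open>(j - 1) / L\<close> to \<open>j / L\<close>; its
      midpoint is the centre at which \<open>count\<close> is applied.\<close>
    have "{x \<in> X. c x = j} \<subseteq> {x \<in> X. \<bar>\<theta> x - (real j - 1 / 2) / real L\<bar> \<le> 1 / (2 * N)}"
    proof safe
      fix x assume "x \<in> X" "j = c x"
      have "\<bar>\<theta> x - (real (c x) - 1 / 2) / real L\<bar> = \<bar>\<theta> x * real L - (real (c x) - 1 / 2)\<bar> / real L"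
        using L(1) by (simp add: field_simps abs_divide)
      also have "\<dots> \<le> (1 / 2) / real L"
        using c(1,2)[OF \<open>x \<in> X\<close>] by (intro divide_right_mono) linarith+
      also have "\<dots> \<le> 1 / (2 * N)"
        using L assms(1) by (simp add: field_simps)
      finally show "\<bar>\<theta> x - (real (c x) - 1 / 2) / real L\<bar> \<le> 1 / (2 * N)" .
    qed
    hence "card {x \<in> X. c x = j} \<le> card {x \<in> X. \<bar>\<theta> x - (real j - 1 / 2) / real L\<bar> \<le> 1 / (2 * N)}"
      using assms(2) by (intro card_mono) auto
    thus ?thesis
      using count[of "(real j - 1 / 2) / real L"] by linarith
  qed
  \<comment> \<open>One grid serves all truncations, since \<open>{1..k}\<close> lies in
    \<open>{1..L}\<close> for every \<open>k \<le> F\<close>.\<close>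
  have parseval: "(\<Sum>j=1..L. (cmod (P k j))\<^sup>2) \<le> real L * sq_norm a N" if "k \<le> F" for k
  proof -
    have "(\<Sum>j=1..L. (cmod (P k j))\<^sup>2) = real L * (\<Sum>n=1..k. (cmod (a n))\<^sup>2)"
      unfolding P_def using that L by (intro discrete_parseval) auto
    also have "\<dots> \<le> real L * (\<Sum>n=1..F. (cmod (a n))\<^sup>2)"
      using that by (intro mult_left_mono sum_mono2) auto
    finally show ?thesis
      by (simp add: sq_norm_def F)
  qed
  have Z: "0 \<le> sq_norm a N"
    unfolding sq_norm_def by (intro sum_nonneg) simp
  have "(\<Sum>j=1..L. G j) = (\<Sum>j=1..L. (cmod (P F j))\<^sup>2) + \<delta> * (\<Sum>k<F. \<Sum>j=1..L. (cmod (P k j))\<^sup>2)"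
    unfolding G_def sum.distrib sum_distrib_left[symmetric] by (subst sum.swap) simp
  also have "\<dots> \<le> real L * sq_norm a N + \<delta> * (\<Sum>k<F. real L * sq_norm a N)"
    by (intro add_mono mult_left_mono sum_mono parseval \<delta>) auto
  also have "\<dots> = (1 + \<delta> * real F) * (real L * sq_norm a N)"
    by (simp add: algebra_simps)
  also have "\<dots> \<le> (1 + 2 * pi) * (real L * sq_norm a N)"
    using \<delta> Z by (intro mult_right_mono) auto
  finally have sumG: "(\<Sum>j=1..L. G j) \<le> (1 + 2 * pi) * (real L * sq_norm a N)" .
  have "(\<Sum>x\<in>X. (cmod (exp_sum a N (\<theta> x)))\<^sup>2) \<le> (\<Sum>x\<in>X. (1 + 2 * pi) * G (c x))"
    by (rule sum_mono) (rule pointwise)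
  also have "\<dots> = (1 + 2 * pi) * (\<Sum>x\<in>X. G (c x))"
    by (simp add: sum_distrib_left)
  also have "(\<Sum>x\<in>X. G (c x)) = (\<Sum>j=1..L. \<Sum>x\<in>{x \<in> X. c x = j}. G (c x))"
    using assms(2) c(3) by (intro sum.group[symmetric]) auto
  also have "\<dots> = (\<Sum>j=1..L. real (card {x \<in> X. c x = j}) * G j)"
    by (intro sum.cong refl) simp
  also have "\<dots> \<le> (\<Sum>j=1..L. K * G j)"
    using cell G0 by (intro sum_mono mult_right_mono) auto
  also have "\<dots> = K * (\<Sum>j=1..L. G j)"
    by (simp add: sum_distrib_left)
  also have "\<dots> \<le> K * ((1 + 2 * pi) * (real L * sq_norm a N))"
    using sumG assms(3) by (intro mult_left_mono)
  also have "\<dots> \<le> K * ((1 + 2 * pi) * (2 * N * sq_norm a N))"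
    using L(3) Z assms(3) by (intro mult_left_mono mult_right_mono) auto
  finally have "(\<Sum>x\<in>X. (cmod (exp_sum a N (\<theta> x)))\<^sup>2)
      \<le> (1 + 2 * pi) * (K * ((1 + 2 * pi) * (2 * N * sq_norm a N)))"
    using pi_gt_zero by (simp add: mult_left_mono)
  thus ?thesis
    by (simp only: power2_eq_square mult_ac)
qed

section \<open>Farey fractions near a rational number of small denominator\<close>

text \<open>The bound \<open>1 / (n + 1)\<close>, rather than the usual \<open>1 / n\<close>, is needed to get both
  \<open>r \<le> \<surd>N\<close> and \<open>\<bar>r \<alpha> - b\<bar> \<le> 1 / \<surd>N\<close> for \<open>n = \<lfloor>\<surd>N\<rfloor>\<close>.\<close>

lemma dirichlet_approx_Suc:
  fixes \<alpha> :: real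
  assumes "0 < n"
  obtains r :: nat and b :: int
  where "0 < r" "r \<le> n" "coprime b (int r)" "\<bar>real r * \<alpha> - of_int b\<bar> \<le> 1 / real (Suc n)"
proof -
  have "\<exists>r b. 0 < r \<and> r \<le> n \<and> \<bar>real r * \<alpha> - of_int b\<bar> \<le> 1 / real (Suc n)"
  proof -
    define f where "f i = nat \<lfloor>frac (real i * \<alpha>) * real (Suc n)\<rfloor>" for i
    have f: "real (f i) \<le> frac (real i * \<alpha>) * real (Suc n)"
        "frac (real i * \<alpha>) * real (Suc n) < real (f i) + 1" for i
      using frac_ge_0[of "real i * \<alpha>"] by (auto simp: f_def intro!: mult_nonneg_nonneg)
    have f_le: "f i \<le> n" for i
    proof -
      have "frac (real i * \<alpha>) * real (Suc n) < 1 * real (Suc n)"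
        by (intro mult_strict_right_mono frac_lt_1) simp
      from le_less_trans[OF f(1) this] show ?thesis by simp
    qed
    have decomp: "real i * \<alpha> = of_int \<lfloor>real i * \<alpha>\<rfloor> + frac (real i * \<alpha>)" for i
      by (simp add: frac_def)
    show ?thesis
    \<comment> \<open>There are \<open>n + 1\<close> multiples, counting \<open>i = 0\<close>, and
      \<open>n + 1\<close> boxes. Either two multiples share a box and their difference works, or
      every box is hit; then some \<open>i\<close> in the last box has \<open>i * \<alpha>\<close>
      within \<open>1 / (n + 1)\<close> of the next integer, and \<open>i\<close> is not 0 because
      \<open>f 0 = 0 < n\<close>.\<close>
    proof (cases "inj_on f {..n}")
      case True
      have "f ` {..n} = {..n}"
        using True f_le by (intro endo_inj_surj) auto
      then obtain i where i: "i \<le> n" "f i = n"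
        by (metis atMost_iff imageE order_refl)
      have "f 0 = 0" by (simp add: f_def)
      hence "0 < i" using i assms by (cases i) auto
      moreover have "\<bar>real i * \<alpha> - of_int (\<lfloor>real i * \<alpha>\<rfloor> + 1)\<bar> = 1 - frac (real i * \<alpha>)"
        using frac_lt_1[of "real i * \<alpha>"] decomp[of i] by simp
      moreover have "1 - frac (real i * \<alpha>) \<le> 1 / real (Suc n)"
        using f(1)[of i] i by (simp add: field_simps)
      ultimately show ?thesis
        using i by metis
    next
      case False
      then obtain i j where ij: "i < j" "j \<le> n" "f i = f j"
        unfolding inj_on_def by (metis atMost_iff linorder_neqE_nat)
      have "\<bar>frac (real j * \<alpha>) - frac (real i * \<alpha>)\<bar> * real (Suc n)
          = \<bar>frac (real j * \<alpha>) * real (Suc n) - frac (real i * \<alpha>) * real (Suc n)\<bar>"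
        by (simp add: abs_mult flip: left_diff_distrib)
      also have "\<dots> \<le> 1"
        using f[of i] f[of j] ij(3) by linarith
      finally have "\<bar>frac (real j * \<alpha>) - frac (real i * \<alpha>)\<bar> \<le> 1 / real (Suc n)"
        by (simp add: field_simps)
      moreover have "real (j - i) * \<alpha> - of_int (\<lfloor>real j * \<alpha>\<rfloor> - \<lfloor>real i * \<alpha>\<rfloor>)
          = frac (real j * \<alpha>) - frac (real i * \<alpha>)"
        using ij(1) by (simp add: frac_def of_nat_diff algebra_simps)
      ultimately show ?thesis
        using ij by (intro exI[of _ "j - i"] exI[of _ "\<lfloor>real j * \<alpha>\<rfloor> - \<lfloor>real i * \<alpha>\<rfloor>"]) auto
    qed
  qed
  then obtain r :: nat and b :: int
    where rb: "0 < r" "r \<le> n" "\<bar>real r * \<alpha> - of_int b\<bar> \<le> 1 / real (Suc n)"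
    by blast
  \<comment> \<open>Reduction to lowest terms divides both the denominator and the error by
    \<open>g\<close>, so both bounds persist.\<close>
  define g where "g = gcd b (int r)"
  have g: "0 < g" using rb(1) by (simp add: g_def)
  obtain b' where b': "b = g * b'" unfolding g_def by (meson dvdE gcd_dvd1)
  obtain r' where r': "int r = g * r'" unfolding g_def by (meson dvdE gcd_dvd2)
  have r'0: "0 < r'" using r' g rb(1) by (metis of_nat_0_less_iff zero_less_mult_pos)
  have "coprime b' r'"
  proof -
    have "g * gcd b' r' = g"
      using g by (metis g_def b' r' gcd_mult_distrib_int abs_of_pos)
    thus ?thesis using g by (simp add: coprime_iff_gcd_eq_1)
  qed
  moreover have "r' \<le> int r"
    using r' g r'0 by (simp add: mult_le_cancel_right1)
  moreover have "\<bar>of_int r' * \<alpha> - of_int b'\<bar> \<le> \<bar>real r * \<alpha> - of_int b\<bar>"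
  proof -
    have "real r = of_int g * of_int r'"
      using r' by (metis of_int_mult of_int_of_nat_eq)
    hence "real r * \<alpha> - of_int b = of_int g * (of_int r' * \<alpha> - of_int b')"
      by (simp add: b' algebra_simps)
    hence "\<bar>real r * \<alpha> - of_int b\<bar> = of_int g * \<bar>of_int r' * \<alpha> - of_int b'\<bar>"
      using g by (simp add: abs_mult)
    moreover have "1 * \<bar>of_int r' * \<alpha> - of_int b'\<bar> \<le> of_int g * \<bar>of_int r' * \<alpha> - of_int b'\<bar>"
      using g by (intro mult_right_mono) auto
    ultimately show ?thesis by simp
  qed
  ultimately show ?thesis
    using rb r'0 by (intro that[of "nat r'" b']) auto
qed

section \<open>Counting the fractions on one side of \<open>b / r\<close>\<close>

text \<open>The interval is cut into \<open>k\<close> windows of length \<open>u\<close>. The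
  maximum in \<open>A_count\<close> covers only windows starting in
  \<open>{M / t .. (M + Q) / t}\<close>, but a window starting further right contains no element of
  \<open>dilate S t\<close>.\<close>

lemma card_interval_le_A_count:
  assumes "finite S" "0 < t" "0 \<le> u" "\<forall>q\<in>S. real q \<le> M + Q" "M / real t \<le> y"
  shows "card {q \<in> dilate S t. y < real q \<and> real q \<le> y + real k * u \<and> [int q = l] (mod int d)}
       \<le> k * A_count M Q S t u d l"
proof (induction k)
  case 0
  have "{q \<in> dilate S t. y < real q \<and> real q \<le> y + real 0 * u \<and> [int q = l] (mod int d)} = {}"
    by auto
  thus ?case by (simp only: card.empty)
next
  case (Suc k)
  define I where "I v w = {q \<in> dilate S t. v < real q \<and> real q \<le> w \<and> [int q = l] (mod int d)}" for v w
  define y' where "y' = y + real k * u"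
  have y': "y + real (Suc k) * u = y' + u"
    by (simp add: y'_def algebra_simps)
  have fin: "finite (I v w)" for v w
    unfolding I_def using finite_dilate[OF assms(1,2)] by simp
  have "card (I y' (y' + u)) \<le> A_count M Q S t u d l"
  proof (cases "y' \<le> (M + Q) / real t")
    case True
    have "M / real t \<le> y'"
      using assms(3,5) by (simp add: y'_def add_increasing2)
    thus ?thesis
      unfolding A_count_def I_def using True finite_A_count_values(1)[OF assms(1,2)]
      by (intro Max_ge) auto
  next
    case False
    have "I y' (y' + u) = {}"
    proof (rule ccontr)
      assume "I y' (y' + u) \<noteq> {}"
      then obtain q where q: "t * q \<in> S" "y' < real q"
        by (auto simp: I_def dilate_def)
      have "real (t * q) \<le> M + Q"
        using assms(4) q(1) by blast
      hence "real q \<le> (M + Q) / real t"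
        using assms(2) by (simp add: field_simps)
      thus False
        using False q(2) by simp
    qed
    thus ?thesis by simp
  qed
  moreover have "card (I y y') \<le> k * A_count M Q S t u d l"
    using Suc.IH by (simp add: I_def y'_def)
  moreover have "card (I y (y' + u)) \<le> card (I y y') + card (I y' (y' + u))"
  proof -
    have "I y (y' + u) \<subseteq> I y y' \<union> I y' (y' + u)"
      by (auto simp: I_def)
    hence "card (I y (y' + u)) \<le> card (I y y' \<union> I y' (y' + u))"
      using fin by (intro card_mono) auto
    thus ?thesis
      using card_Un_le order_trans by blast
  qed
  ultimately show ?case
    unfolding y' I_def[symmetric] by simp
qed

text \<open>A pair \<open>(q, a)\<close> in \<open>X\<close> stands for the fraction \<open>a / q\<close>, lying on the side \<open>s = \<plusminus>1\<close> of \<open>b / r\<close>.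
  It is sorted according to \<open>t = gcd q r\<close> and to the numerator \<open>t m\<close> of \<open>s (a / q - b / r)\<close>; these
  determine \<open>q / t\<close> modulo \<open>r / t\<close>, and \<open>q\<close> then determines \<open>a\<close>.\<close>

lemma card_one_side_le_divisor_sum:
  fixes X :: "(nat \<times> nat) set" and b s h :: int
  assumes S: "finite S" "\<forall>q\<in>S. M < real q \<and> real q \<le> M + Q" and "0 \<le> M"
    and "0 < r" and b: "coprime b (int r)" and s: "s * s = 1" and h: "[h * b = - s] (mod int r)"
    and v: "0 < Q / (z * N)" and "finite X" and XS: "\<And>q a. (q, a) \<in> X \<Longrightarrow> q \<in> S"
    and pos: "\<And>q a. (q, a) \<in> X \<Longrightarrow> 0 < s * (int a * int r - b * int q)"
    and bound: "\<And>q a. (q, a) \<in> X \<Longrightarrow> of_int (s * (int a * int r - b * int q)) \<le> 4 * real r * z * Q"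
    and near: "\<And>q a q' a'. (q, a) \<in> X \<Longrightarrow> (q', a') \<in> X \<Longrightarrow>
      int a * int r - b * int q = int a' * int r - b * int q' \<Longrightarrow> real q' \<le> real q + 4 * (Q / (z * N))"
  shows "card X \<le> 5 * divisor_sum N M Q S r z h"
proof -
  define v where "v = Q / (z * N)"
  define Ms where "Ms t = {m. 0 < m \<and> real m \<le> 4 * real r * z * Q / real t \<and> coprime m (r div t)}" for t
  define Y where "Y t m = {x \<in> X. gcd (fst x) r = t \<and>
      s * (int (snd x) * int r - b * int (fst x)) = int t * int m}" for t m
  have finMs: "finite (Ms t)" for t
    unfolding Ms_def by (rule finite_subset[of _ "{..nat \<lfloor>4 * real r * z * Q / real t\<rfloor>}"])
      (auto simp: le_nat_floor)
  have finT: "finite {t. t dvd r}"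
    using \<open>0 < r\<close> by simp
  have finY: "finite (Y t m)" for t m
    unfolding Y_def using \<open>finite X\<close> by simp
  have cover: "X \<subseteq> (\<Union>t\<in>{t. t dvd r}. \<Union>m\<in>Ms t. Y t m)"
  proof safe
    fix q a assume qa: "(q, a) \<in> X"
    define t where "t = gcd q r"
    have t: "0 < t" "t dvd r" "t dvd q"
      using \<open>0 < r\<close> by (auto simp: t_def)
    obtain r' q' where rq: "r = t * r'" "q = t * q'"
      using t by (meson dvdE)
    have cop: "coprime q' r'"
    proof -
      have "t * gcd q' r' = t"
        by (metis t_def rq gcd_mult_distrib_nat)
      thus ?thesis using t by (simp add: coprime_iff_gcd_eq_1)
    qed
    define m where "m = s * (int a * int r' - b * int q')"
    have m: "s * (int a * int r - b * int q) = int t * m"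
      by (simp add: rq m_def algebra_simps)
    have m0: "0 < m"
      using pos[OF qa] t(1) unfolding m by (simp add: zero_less_mult_iff)
    have mle: "real (nat m) \<le> 4 * real r * z * Q / real t"
      using bound[OF qa] t(1) m0 unfolding m by (simp add: field_simps)
    \<comment> \<open>Modulo \<open>r'\<close> the number \<open>m\<close> is
      \<open>- s * b * q'\<close>, a product of units.\<close>
    have "coprime m (int r')"
    proof -
      have "coprime b (int r')"
        using b by (simp add: rq)
      moreover have "coprime s (int r')"
        using s by (metis dvd_triv_left is_unit_left_imp_coprime)
      ultimately have "coprime (- (s * b * int q')) (int r')"
        using cop by simp
      moreover have "m = - (s * b * int q') + (s * int a) * int r'"
        by (simp add: m_def algebra_simps)
      ultimately show ?thesis
        by (metis coprime_iff_gcd_eq_1 gcd.commute gcd_add_mult add.commute)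
    qed
    hence "coprime (nat m) r'"
      using m0 by (metis coprime_int_iff int_nat_eq less_imp_le)
    hence "nat m \<in> Ms t"
      using m0 mle t(1) by (simp add: Ms_def rq)
    moreover have "(q, a) \<in> Y t (nat m)"
      using qa m m0 by (simp add: Y_def t_def)
    ultimately show "(q, a) \<in> (\<Union>t\<in>{t. t dvd r}. \<Union>m\<in>Ms t. Y t m)"
      using t by blast
  qed
  have cell: "card (Y t m) \<le> 5 * A_count M Q S t (Q / (real t * z * N)) (r div t) (h * int m)"
    if "t dvd r" for t m
  proof (cases "Y t m = {}")
    case False
    obtain r' where r': "r = t * r'" using \<open>t dvd r\<close> by (rule dvdE)
    have t0: "0 < t" using \<open>0 < r\<close> r' by simp
    \<comment> \<open>All denominators of the cell lie in \<open>{q0 .. q0 + 4 * v}\<close> by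
      \<open>near\<close>. Starting at \<open>q0 - v\<close> makes the half-open interval contain
      \<open>q0\<close> and raises the length to \<open>5 * v\<close>; the maximum with
      \<open>M\<close> keeps the starting point admissible for \<open>A_count\<close>.\<close>
    define q0 where "q0 = Min (fst ` Y t m)"
    define y where "y = max M (real q0 - v)"
    have "q0 \<in> fst ` Y t m"
      unfolding q0_def using False finY by (intro Min_in) auto
    then obtain a0 where q0: "(q0, a0) \<in> Y t m" by auto
    let ?I = "{q \<in> dilate S t. y / real t < real q \<and>
        real q \<le> y / real t + real 5 * (Q / (real t * z * N)) \<and> [int q = h * int m] (mod int r')}"
    have inj: "inj_on (\<lambda>x. fst x div t) (Y t m)"
    proof (rule inj_onI, clarify)
      fix q a q' a' assume *: "(q, a) \<in> Y t m" "(q', a') \<in> Y t m" "fst (q, a) div t = fst (q', a') div t"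
      hence "t = gcd q r" "t = gcd q' r" by (auto simp: Y_def)
      hence "t dvd q" "t dvd q'" by (metis gcd_dvd1)+
      hence qq: "q = q'" using *(3) by (metis dvd_mult_div_cancel fst_conv)
      have "s * s * (int a * int r - b * int q) = s * s * (int a' * int r - b * int q')"
        using * by (simp add: Y_def mult.assoc)
      hence "a = a'" using s qq \<open>0 < r\<close> by simp
      thus "q = q' \<and> a = a'" using qq by simp
    qed
    have "(\<lambda>x. fst x div t) ` Y t m \<subseteq> ?I"
    proof safe
      fix q a assume qa: "(q, a) \<in> Y t m"
      hence qX: "(q, a) \<in> X" and "t dvd q" and eq: "s * (int a * int r - b * int q) = int t * int m"
        by (auto simp: Y_def)
      then obtain q' where q': "q = t * q'" by (meson dvdE)
      have qdiv: "fst (q, a) div t = q'" using t0 q' by simp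
      have qS: "M < real q" "q \<in> S" using S XS[OF qX] by auto
      show "fst (q, a) div t \<in> dilate S t"
        unfolding qdiv using qS \<open>0 \<le> M\<close> q' by (auto simp: dilate_def intro: Nat.gr0I)
      have q0X: "(q0, a0) \<in> X" and eq0: "s * (int a0 * int r - b * int q0) = int t * int m"
        using q0 by (auto simp: Y_def)
      have "q0 \<le> q"
        unfolding q0_def using finY qa by (intro Min_le) force+
      moreover have "M < real q0" using S XS[OF q0X] by auto
      moreover have "0 < v" using v by (simp add: v_def)
      moreover have "s * s * (int a0 * int r - b * int q0) = s * s * (int a * int r - b * int q)"
        using eq eq0 by (simp add: mult.assoc)
      hence "real q \<le> real q0 + 4 * v"
        unfolding v_def using s by (intro near[OF q0X qX]) simp
      ultimately have yq: "y < real q" "real q \<le> y + 5 * v"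
        by (auto simp: y_def)
      show "y / real t < real (fst (q, a) div t)"
        unfolding qdiv using yq(1) t0 by (simp add: q' field_simps)
      have "real q / real t \<le> (y + 5 * v) / real t"
        using yq(2) by (rule divide_right_mono) simp
      thus "real (fst (q, a) div t) \<le> y / real t + real 5 * (Q / (real t * z * N))"
        unfolding qdiv using t0 by (simp add: q' v_def add_divide_distrib mult_ac)
      \<comment> \<open>Since \<open>h\<close> is \<open>- s\<close> times the inverse of
        \<open>b\<close>, multiplying \<open>m = s * (a * r' - b * q')\<close> by \<open>h\<close>
        leaves \<open>s * s * q' = q'\<close> modulo \<open>r'\<close>.\<close>
      obtain c where c: "h * b = - s + int r * c"
        using h by (metis cong_iff_lin cong_sym)
      have "int t * int m = int t * (s * (int a * int r' - b * int q'))"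
        using eq by (simp add: r' q' algebra_simps)
      hence "int m = s * (int a * int r' - b * int q')"
        using t0 by simp
      hence "h * int m = h * s * int a * int r' - s * (h * b) * int q'"
        by (simp only:) (simp add: algebra_simps)
      also have "\<dots> = h * s * int a * int r' + (s * s) * int q' - s * int r * c * int q'"
        unfolding c by (simp add: algebra_simps)
      also have "\<dots> = int q' + int r' * (h * s * int a - s * int t * c * int q')"
        unfolding s r' by (simp add: algebra_simps)
      finally show "[int (fst (q, a) div t) = h * int m] (mod int r')"
        unfolding qdiv by (simp add: cong_iff_lin)
    qed
    hence "card (Y t m) \<le> card ?I"
      using finite_dilate[OF S(1) t0] by (intro card_inj_on_le[OF inj]) auto
    also have "\<dots> \<le> 5 * A_count M Q S t (Q / (real t * z * N)) r' (h * int m)"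
    proof (rule card_interval_le_A_count[OF S(1) t0])
      show "0 \<le> Q / (real t * z * N)"
        using divide_nonneg_nonneg[OF less_imp_le[OF v], of "real t"] by (simp add: mult_ac)
      show "M / real t \<le> y / real t"
        by (intro divide_right_mono) (auto simp: y_def)
    qed (use S in auto)
    finally show ?thesis
      using r' t0 by simp
  qed simp
  have "card X \<le> card (\<Union>t\<in>{t. t dvd r}. \<Union>m\<in>Ms t. Y t m)"
    using finT finMs finY by (intro card_mono[OF _ cover]) auto
  also have "\<dots> \<le> (\<Sum>t | t dvd r. \<Sum>m\<in>Ms t. card (Y t m))"
    by (rule order_trans[OF card_UN_le[OF finT]]) (intro sum_mono card_UN_le finMs)
  also have "\<dots> \<le> (\<Sum>t | t dvd r. \<Sum>m\<in>Ms t. 5 * A_count M Q S t (Q / (real t * z * N)) (r div t) (h * int m))"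
    by (intro sum_mono cell) simp
  also have "\<dots> = 5 * divisor_sum N M Q S r z h"
    by (simp add: divisor_sum_def Ms_def sum_distrib_left)
  finally show ?thesis .
qed

section \<open>The number of fractions in an interval of length \<open>1 / N\<close>\<close>

lemma divisor_sum_le_max:
  assumes "finite S" "1 \<le> N" "0 \<le> Q" "0 < r" "real r \<le> sqrt N"
    and "1 / N \<le> z" "z \<le> 1 / (real r * sqrt N)" "coprime h (int r)"
  shows "divisor_sum N M Q S r z h \<le> max_divisor_sum N M Q S"
proof -
  note wd = max_divisor_sum_well_defined[OF assms(1-3)]
  have "divisor_sum N M Q S r z h \<le> (MAX h \<in> {h. coprime h (int r)}. divisor_sum N M Q S r z h)"
    using assms(8) by (intro Max_ge wd(6) assms(4)) auto
  also have "\<dots> \<le> (MAX z \<in> {1 / N .. 1 / (real r * sqrt N)}.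
      MAX h \<in> {h. coprime h (int r)}. divisor_sum N M Q S r z h)"
    using assms(6,7) by (intro Max_ge wd(5) assms(4)) auto
  also have "\<dots> \<le> max_divisor_sum N M Q S"
    unfolding max_divisor_sum_def using assms(4,5) wd(1) by (intro Max_ge) auto
  finally show ?thesis .
qed

text \<open>For the Dirichlet approximation \<open>b / r\<close> to \<alpha>, the fractions are
  split by the sign of \<open>a * r - b * q\<close>. The value 0 occurs for at most the single
  fraction \<open>b / r\<close>, and each of the two signs contributes at most
  \<open>5 * max_divisor_sum N M Q S\<close>.\<close>

lemma card_farey_near_le:
  fixes S :: "nat set" and \<alpha> :: real
  defines "P \<equiv> Sigma S (\<lambda>q. {b. b \<in> {1..q} \<and> coprime b q})"
  assumes "1 \<le> Q" "1 \<le> N" "0 \<le> M" "M \<le> Q" and SM: "\<forall>q\<in>S. M < real q \<and> real q \<le> M + Q"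
    and finS: "finite S"
  shows "real (card {x \<in> P. \<bar>real (snd x) / real (fst x) - \<alpha>\<bar> \<le> 1 / (2 * N)})
       \<le> U_ind M N + 10 * real (max_divisor_sum N M Q S)"
proof -
  define X where "X = {x \<in> P. \<bar>real (snd x) / real (fst x) - \<alpha>\<bar> \<le> 1 / (2 * N)}"
  have finX: "finite X"
    unfolding X_def P_def using finS by auto
  have sqrtN: "1 \<le> sqrt N" using \<open>1 \<le> N\<close> by simp
  have "0 < nat \<lfloor>sqrt N\<rfloor>" using sqrtN by linarith
  then obtain r :: nat and b :: int where r: "0 < r" "r \<le> nat \<lfloor>sqrt N\<rfloor>" and b: "coprime b (int r)"
    and rb: "\<bar>real r * \<alpha> - of_int b\<bar> \<le> 1 / real (Suc (nat \<lfloor>sqrt N\<rfloor>))"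
    by (rule dirichlet_approx_Suc)
  have r_le: "real r \<le> sqrt N" using r(2) sqrtN by linarith
  have "1 / real (Suc (nat \<lfloor>sqrt N\<rfloor>)) \<le> 1 / sqrt N"
    using sqrtN by (intro divide_left_mono mult_pos_pos) linarith+
  define \<zeta> where "\<zeta> = \<alpha> - of_int b / real r"
  have "\<bar>\<zeta>\<bar> = \<bar>real r * \<alpha> - of_int b\<bar> / real r"
    using r(1) by (simp add: \<zeta>_def field_simps abs_divide)
  also have "\<dots> \<le> (1 / sqrt N) / real r"
    using rb \<open>1 / real (Suc (nat \<lfloor>sqrt N\<rfloor>)) \<le> 1 / sqrt N\<close> by (intro divide_right_mono) auto
  finally have \<zeta>: "\<bar>\<zeta>\<bar> \<le> 1 / (real r * sqrt N)"
    by (simp add: mult.commute)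
  \<comment> \<open>When \<open>\<bar>\<zeta>\<bar>\<close> is below \<open>1 / N\<close>, the
    length of the interval outweighs its offset from \<open>b / r\<close>, and \<open>1 / N\<close>
    takes over as the scale.\<close>
  define z where "z = max \<bar>\<zeta>\<bar> (1 / N)"
  have rN: "real r * sqrt N \<le> N"
    using mult_right_mono[OF r_le, of "sqrt N"] \<open>1 \<le> N\<close> by simp
  have z: "1 / N \<le> z" "z \<le> 1 / (real r * sqrt N)" "0 < z"
  proof -
    have "1 / N \<le> 1 / (real r * sqrt N)"
      using rN r(1) sqrtN \<open>1 \<le> N\<close> by (intro divide_left_mono) auto
    thus "z \<le> 1 / (real r * sqrt N)" using \<zeta> by (simp add: z_def)
    show "1 / N \<le> z" by (simp add: z_def)
    moreover have "0 < 1 / N" using \<open>1 \<le> N\<close> by simp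
    ultimately show "0 < z" by linarith
  qed
  define X' where "X' s = {x \<in> X. 0 < s * (int (snd x) * int r - b * int (fst x))}" for s
  define X0 where "X0 = {x \<in> X. int (snd x) * int r = b * int (fst x)}"
  have inX: "q \<in> S" "0 < q" "coprime a q" "M < real q" "real q \<le> 2 * Q"
    "\<bar>of_int (int a * int r - b * int q) - \<zeta> * (real q * real r)\<bar> \<le> real q * real r / (2 * N)"
    if "(q, a) \<in> X" for q a
  proof -
    have *: "q \<in> S" "1 \<le> a" "a \<le> q" "coprime a q" "\<bar>real a / real q - \<alpha>\<bar> \<le> 1 / (2 * N)"
      using that by (auto simp: X_def P_def)
    show "q \<in> S" "coprime a q" by fact+
    show "0 < q" using * by simp
    show "M < real q" using SM * by blast
    show "real q \<le> 2 * Q" using SM * \<open>M \<le> Q\<close> by force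
    have "of_int (int a * int r - b * int q) - \<zeta> * (real q * real r)
        = (real a / real q - \<alpha>) * (real q * real r)"
      using \<open>0 < q\<close> r(1) by (simp add: \<zeta>_def field_simps)
    hence "\<bar>of_int (int a * int r - b * int q) - \<zeta> * (real q * real r)\<bar>
        = \<bar>real a / real q - \<alpha>\<bar> * (real q * real r)"
      by (simp add: abs_mult)
    also have "\<dots> \<le> 1 / (2 * N) * (real q * real r)"
      using *(5) by (intro mult_right_mono) auto
    finally show "\<bar>of_int (int a * int r - b * int q) - \<zeta> * (real q * real r)\<bar> \<le> real q * real r / (2 * N)"
      by simp
  qed
  have side: "card (X' s) \<le> 5 * max_divisor_sum N M Q S" if s: "s = 1 \<or> s = -1" for s :: int
  proof -
    have ss: "s * s = 1" using s by auto
    define \<xi> where "\<xi> = of_int s * \<zeta>"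
    obtain w where w: "[b * w = 1] (mod int r)"
      using b cong_solve_coprime_int by blast
    define h where "h = - s * w"
    have h: "[h * b = - s] (mod int r)"
    proof -
      have "[- s * (b * w) = - s * 1] (mod int r)"
        by (intro cong_mult w cong_refl)
      thus ?thesis by (simp add: h_def mult_ac)
    qed
    have coph: "coprime h (int r)"
    proof -
      have "coprime w (int r)"
        using w coprime_iff_invertible_int by (metis mult.commute)
      moreover have "coprime s (int r)" using s by auto
      ultimately show ?thesis by (simp add: h_def)
    qed
    have inX': "0 < s * (int a * int r - b * int q)"
      "of_int (s * (int a * int r - b * int q)) \<le> real q * real r * (\<xi> + 1 / (2 * N))"
      "real q * real r * (\<xi> - 1 / (2 * N)) \<le> of_int (s * (int a * int r - b * int q))"
      "(q, a) \<in> X" if "(q, a) \<in> X' s" for q a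
    proof -
      show *: "0 < s * (int a * int r - b * int q)" "(q, a) \<in> X"
        using that by (auto simp: X'_def)
      have "\<bar>of_int (s * (int a * int r - b * int q)) - \<xi> * (real q * real r)\<bar> \<le> real q * real r / (2 * N)"
        using inX(6)[OF *(2)] s by (auto simp: \<xi>_def)
      thus "of_int (s * (int a * int r - b * int q)) \<le> real q * real r * (\<xi> + 1 / (2 * N))"
        "real q * real r * (\<xi> - 1 / (2 * N)) \<le> of_int (s * (int a * int r - b * int q))"
        by (auto simp: algebra_simps abs_le_iff)
    qed
    have \<xi>: "\<xi> \<le> \<bar>\<zeta>\<bar>" "\<bar>\<xi>\<bar> = \<bar>\<zeta>\<bar>" using s by (auto simp: \<xi>_def)
    have half: "1 / (2 * N) \<le> z / 2" using z(1) by simp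
    have "card (X' s) \<le> 5 * divisor_sum N M Q S r z h"
    proof (rule card_one_side_le_divisor_sum[OF finS SM \<open>0 \<le> M\<close> r(1) b ss h])
      show "0 < Q / (z * N)" using z \<open>1 \<le> Q\<close> \<open>1 \<le> N\<close> by simp
      show "finite (X' s)" using finX by (simp add: X'_def)
    next
      fix q a assume qa: "(q, a) \<in> X' s"
      note * = inX'[OF qa]
      show "q \<in> S" using inX *(4) by blast
      show "0 < s * (int a * int r - b * int q)" by (rule *)
      \<comment> \<open>Together with \<open>q \<le> 2 * Q\<close> this produces the factor 4 in the
        range of \<open>m\<close>.\<close>
      have "\<xi> + 1 / (2 * N) \<le> 2 * z" using \<xi> half z by (simp add: z_def)
      hence "real q * real r * (\<xi> + 1 / (2 * N)) \<le> real q * real r * (2 * z)"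
        by (intro mult_left_mono) auto
      also have "\<dots> \<le> 2 * Q * real r * (2 * z)"
        using inX(5)[OF *(4)] z by (intro mult_right_mono) auto
      finally show "of_int (s * (int a * int r - b * int q)) \<le> 4 * real r * z * Q"
        using *(2) by (simp add: mult_ac)
    next
      fix q a q' a'
      assume qa: "(q, a) \<in> X' s" "(q', a') \<in> X' s"
        and eq: "int a * int r - b * int q = int a' * int r - b * int q'"
      note q = inX'[OF qa(1)] and q' = inX'[OF qa(2)]
      show "real q' \<le> real q + 4 * (Q / (z * N))"
      \<comment> \<open>For small \<xi> the claimed window has length \<open>4 * Q\<close> and holds
        every denominator, as these are at most \<open>2 * Q\<close>.\<close>
      proof (cases "\<bar>\<xi>\<bar> \<le> 1 / N")
        case True
        hence "z = 1 / N" using \<xi> by (simp add: z_def)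
        hence "Q / (z * N) = Q" using \<open>1 \<le> N\<close> by simp
        moreover have "real q' \<le> 2 * Q" using inX(5)[OF q'(4)] .
        ultimately show ?thesis using \<open>1 \<le> Q\<close> by linarith
      next
        case False
        \<comment> \<open>A positive numerator forces \<open>\<xi> > - 1 / (2 * N)\<close>; as
          \<open>\<bar>\<xi>\<bar> > 1 / N\<close>, \<xi> is positive and equals
          \<open>z\<close>.\<close>
        have "0 < real q * real r * (\<xi> + 1 / (2 * N))"
          using q(1,2) by (metis of_int_0_less_iff less_le_trans)
        hence "0 < \<xi> + 1 / (2 * N)"
          by (rule zero_less_mult_pos) (use inX(2)[OF q(4)] r(1) in simp)
        moreover have "1 / (2 * N) < 1 / N" using \<open>1 \<le> N\<close> by (simp add: field_simps)
        ultimately have zx: "z = \<xi>" using False \<xi> by (auto simp: z_def)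
        \<comment> \<open>The common numerator is bounded below through \<open>q'\<close> and above
          through \<open>q\<close>. As \<open>z - 1 / (2 * N) \<ge> z / 2\<close> and
          \<open>q \<le> 2 * Q\<close>, this limits \<open>q' - q\<close> to
          \<open>4 * Q / (z * N)\<close>.\<close>
        have "real r * (real q' * (\<xi> - 1 / (2 * N))) \<le> real r * (real q * (\<xi> + 1 / (2 * N)))"
          using q(2) q'(3) eq by (simp add: mult_ac)
        hence "real q' * (z - 1 / (2 * N)) \<le> real q * (z + 1 / (2 * N))"
          using r(1) by (simp add: zx)
        moreover have "real q * (1 / N) = 2 * (real q * (1 / (2 * N)))"
          by simp
        ultimately have "(real q' - real q) * (z - 1 / (2 * N)) \<le> real q * (1 / N)"
          by (simp only: left_diff_distrib right_diff_distrib distrib_left)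
        also have "\<dots> \<le> 2 * Q * (1 / N)"
          using inX(5)[OF q(4)] \<open>1 \<le> N\<close> by (intro mult_right_mono) auto
        finally have diff: "(real q' - real q) * (z - 1 / (2 * N)) \<le> 2 * Q / N" by simp
        show ?thesis
        proof (cases "q \<le> q'")
          case True
          hence "(real q' - real q) * (z / 2) \<le> (real q' - real q) * (z - 1 / (2 * N))"
            using half by (intro mult_left_mono) auto
          hence "(real q' - real q) * (z / 2) \<le> 2 * Q / N" using diff by linarith
          thus ?thesis using z \<open>1 \<le> N\<close> by (simp add: field_simps)
        next
          case False
          moreover have "0 \<le> Q / (z * N)" using z \<open>1 \<le> Q\<close> \<open>1 \<le> N\<close> by simp
          ultimately show ?thesis by linarith
        qed
      qed
    qed
    also have "\<dots> \<le> 5 * max_divisor_sum N M Q S"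
      using divisor_sum_le_max[OF finS \<open>1 \<le> N\<close> _ r(1) r_le z(1,2) coph] \<open>1 \<le> Q\<close> by simp
    finally show ?thesis .
  qed
  have X0: "real (card X0) \<le> U_ind M N"
  proof (cases "X0 = {}")
    case False
    have eq: "q = r \<and> int a = b" if "(q, a) \<in> X0" for q a
    proof -
      have *: "int a * int r = b * int q" "coprime a q" "0 < q"
        using that inX by (auto simp: X0_def)
      have "int q dvd int a * int r" using *(1) by simp
      hence "int q dvd int r"
        using *(2) by (metis coprime_commute coprime_dvd_mult_right_iff coprime_int_iff)
      moreover have "int r dvd b * int q" using *(1) by (metis dvd_triv_right)
      hence "int r dvd int q"
        using b by (metis coprime_commute coprime_dvd_mult_right_iff)
      ultimately have "q = r" by (simp add: dvd_antisym)
      thus ?thesis using * by simp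
    qed
    then obtain a where a: "(r, a) \<in> X0" using False by fast
    have "X0 \<subseteq> {(r, nat b)}" using eq by fastforce
    hence "card X0 \<le> 1" using card_mono[of "{(r, nat b)}" X0] by simp
    \<comment> \<open>A vanishing numerator puts \<open>r\<close> itself into \<open>S\<close>, so
      \<open>M < r \<le> sqrt N\<close> and \<open>U_ind M N\<close> is 1.\<close>
    moreover have "M < real r" using inX(4) a by (auto simp: X0_def)
    ultimately show ?thesis using r_le by (simp add: U_ind_def)
  qed (simp add: U_ind_def)
  have "X \<subseteq> X0 \<union> (X' 1 \<union> X' (-1))"
    by (auto simp: X0_def X'_def)
  hence "card X \<le> card (X0 \<union> (X' 1 \<union> X' (-1)))"
    using finX by (intro card_mono) (auto simp: X0_def X'_def)
  also have "\<dots> \<le> card X0 + (card (X' 1) + card (X' (-1)))"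
    by (rule order_trans[OF card_Un_le]) (simp add: card_Un_le)
  also have "\<dots> \<le> card X0 + (5 * max_divisor_sum N M Q S + 5 * max_divisor_sum N M Q S)"
    by (intro add_mono side) auto
  finally have "real (card X) \<le> real (card X0) + 10 * real (max_divisor_sum N M Q S)"
    by simp
  thus ?thesis
    using X0 by (simp add: X_def)
qed

section \<open>The large sieve inequality for the moduli in \<open>S\<close>\<close>

theorem theorem1:
  shows "\<exists>c1::real. c1 > 0 \<and>
    (\<forall>(Q::real) (N::real) (a::nat \<Rightarrow> complex) (M::real) (S::nat set).
       1 \<le> Q \<longrightarrow> 1 \<le> N \<longrightarrow> 0 \<le> M \<longrightarrow> M \<le> Q \<longrightarrow>
       (\<forall>q\<in>S. M < real q \<and> real q \<le> M + Q) \<longrightarrow>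
       (\<Sum>q\<in>S. \<Sum>b | b \<in> {1..q} \<and> coprime b q. (cmod (exp_sum a N (real b / real q)))\<^sup>2)
         \<le> c1 * N * sq_norm a N * (U_ind M N + real (max_divisor_sum N M Q S)))"
proof (intro exI[of _ "20 * (1 + 2 * pi)\<^sup>2"] conjI allI impI)
  have "0 < 1 + 2 * pi" using pi_gt_zero by linarith
  thus "0 < 20 * (1 + 2 * pi)\<^sup>2" by simp
next
  fix Q N :: real and a :: "nat \<Rightarrow> complex" and M :: real and S :: "nat set"
  assume A: "1 \<le> Q" "1 \<le> N" "0 \<le> M" "M \<le> Q" and SM: "\<forall>q\<in>S. M < real q \<and> real q \<le> M + Q"
  define K where "K = U_ind M N + real (max_divisor_sum N M Q S)"
  define P where "P = Sigma S (\<lambda>q. {b. b \<in> {1..q} \<and> coprime b q})"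
  have finS: "finite S"
    by (rule finite_subset[of _ "{..nat \<lfloor>M + Q\<rfloor>}"]) (use SM in \<open>auto simp: le_nat_floor\<close>)
  have K: "0 \<le> K" "U_ind M N + 10 * real (max_divisor_sum N M Q S) \<le> 10 * K"
    by (auto simp: K_def U_ind_def)
  have Z: "0 \<le> sq_norm a N"
    unfolding sq_norm_def by (intro sum_nonneg) simp
  have "(\<Sum>q\<in>S. \<Sum>b | b \<in> {1..q} \<and> coprime b q. (cmod (exp_sum a N (real b / real q)))\<^sup>2)
      = (\<Sum>x\<in>P. (cmod (exp_sum a N (real (snd x) / real (fst x))))\<^sup>2)"
    unfolding P_def using finS by (subst sum.Sigma) (auto simp: case_prod_unfold)
  \<comment> \<open>The local count is at most \<open>10 * K\<close>, which with the factor
    \<open>2 * (1 + 2 * pi)\<^sup>2\<close> of the sieve gives the constant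
    \<open>20 * (1 + 2 * pi)\<^sup>2\<close>.\<close>
  also have "\<dots> \<le> 2 * (1 + 2 * pi)\<^sup>2 * (10 * K) * N * sq_norm a N"
  proof (rule large_sieve_local_count[OF A(2)])
    show "finite P" unfolding P_def using finS by auto
    show "0 \<le> 10 * K" using K by simp
    show "0 < real (snd x) / real (fst x) \<and> real (snd x) / real (fst x) \<le> 1" if "x \<in> P" for x
      using that by (auto simp: P_def)
    show "real (card {x \<in> P. \<bar>real (snd x) / real (fst x) - \<alpha>\<bar> \<le> 1 / (2 * N)}) \<le> 10 * K" for \<alpha>
      using card_farey_near_le[OF A SM finS, of \<alpha>] K(2) unfolding P_def by linarith
  qed
  finally show "(\<Sum>q\<in>S. \<Sum>b | b \<in> {1..q} \<and> coprime b q. (cmod (exp_sum a N (real b / real q)))\<^sup>2)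
      \<le> 20 * (1 + 2 * pi)\<^sup>2 * N * sq_norm a N * (U_ind M N + real (max_divisor_sum N M Q S))"
    by (simp add: K_def algebra_simps)
qed

end
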